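(* Let $p\ge 1$ and let $\Phi:\mathbb{R}^n\to\mathbb{R}^m$ be a polynomial map of degree $p$, let $y\in\mathbb{R}^m$ be fixed, and let $f(x)=\frac12\|\Phi(x)-y\|^2$. Write $\Phi=\Phi_p+\Phi_{p-1}+\cdots+\Phi_0$, where $\Phi_k$ is homogeneous of degree $k$, and define $f_{2p}(x)=\frac12\|\Phi_p(x)\|^2$. Assume that $\nabla f_{2p}(u)\neq 0$ for every $u\in\mathbb{S}^{n-1}$. Then there exist constants $L_0,L_1>0$ such that $$\|\nabla^2 f(x)\|\le L_0+L_1\|\nabla f(x)\|^{\alpha},\qquad \alpha=\frac{2p-2}{2p-1},\qquad \forall x\in\mathbb{R}^n.$$
   Context: $\|\cdot\|$ is the Euclidean norm on vectors and the induced operator norm on matrices. $\mathbb{S}^{n-1}$ is the Euclidean unit sphere of $\mathbb{R}^n$. A polynomial map $P:\mathbb{R}^n\to\mathbb{R}^m$ is homogeneous of degree $k$ if $P(tx)=t^kP(x)$ for all $x\in\mathbb{R}^n$, $t\in\mathbb{R}$. Convention: $0^0=1$ (relevant for $p=1$, where $\alpha=0$). *)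

theory Defs
  imports "HOL-Analysis.Analysis"
begin

text \<open>
  Total degree of a polynomial map, read off from its monomial expansion with vector
  coefficients \<open>c e\<close>, where \<open>e\<close> ranges over the multi-exponents. The sum is over
  a finite set (lemma \<open>finite_multiexponents\<close> below). \<open>poly_map_degree\<close> is only
  meaningful for polynomial maps; the zero map gets degree 0.
\<close>

definition poly_map_degree_le :: "nat \<Rightarrow> (real^'n \<Rightarrow> real^'m) \<Rightarrow> bool" where
  "poly_map_degree_le d P \<longleftrightarrow>
     (\<exists>c :: ('n \<Rightarrow> nat) \<Rightarrow> real^'m. \<forall>x.
        P x = (\<Sum>e | (\<Sum>i\<in>UNIV. e i) \<le> d. (\<Prod>i\<in>UNIV. (x $ i) ^ e i) *\<^sub>R c e))"

definition poly_map_degree :: "(real^'n \<Rightarrow> real^'m) \<Rightarrow> nat" where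
  "poly_map_degree P = (LEAST d. poly_map_degree_le d P)"

lemma finite_multiexponents:
  "finite {e :: 'n::finite \<Rightarrow> nat. (\<Sum>i\<in>UNIV. e i) \<le> d}"
proof (rule finite_subset)
  show "{e :: 'n \<Rightarrow> nat. (\<Sum>i\<in>UNIV. e i) \<le> d} \<subseteq> (\<Pi>\<^sub>E i\<in>UNIV. {..d})"
  proof
    fix e :: "'n \<Rightarrow> nat"
    assume e: "e \<in> {e. (\<Sum>i\<in>UNIV. e i) \<le> d}"
    have "e i \<le> d" for i
      using member_le_sum[of i UNIV e] e by simp
    then show "e \<in> (\<Pi>\<^sub>E i\<in>UNIV. {..d})"
      by (auto simp: PiE_def Pi_def)
  qed
  show "finite (\<Pi>\<^sub>E i\<in>(UNIV :: 'n set). {..d})"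
    by (rule finite_PiE) auto
qed

definition homogeneous_poly_map :: "nat \<Rightarrow> (real^'n \<Rightarrow> real^'m) \<Rightarrow> bool" where
  "homogeneous_poly_map k P \<longleftrightarrow>
     polynomial_function P \<and> (\<forall>x t. P (t *\<^sub>R x) = t ^ k *\<^sub>R P x)"

text \<open>Only meaningful where \<open>f\<close> is differentiable.\<close>

definition gradient :: "('a::real_inner \<Rightarrow> real) \<Rightarrow> 'a \<Rightarrow> 'a" where
  "gradient f x = (THE D. GDERIV f x :> D)"

lemma gradient_eqI:
  assumes "GDERIV f x :> D"
  shows "gradient f x = D"
  unfolding gradient_def
proof (rule the_equality[of "\<lambda>D. GDERIV f x :> D", OF assms])
  fix D' assume "GDERIV f x :> D'"
  then have "(\<lambda>h. inner h D') = (\<lambda>h. inner h D)"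
    using assms unfolding gderiv_def by (rule has_derivative_unique)
  then have "inner h D' = inner h D" for h by metis
  then have "inner (D' - D) (D' - D) = 0" by (simp add: inner_diff_right)
  then show "D' = D" by simp
qed

definition hessian :: "(real^'n \<Rightarrow> real) \<Rightarrow> real^'n \<Rightarrow> real^'n^'n" where
  "hessian f x = jacobian (gradient f) (at x)"

text \<open>The operator norm induced by the Euclidean norm; the library's \<open>norm\<close> on
  \<open>real^'n^'m\<close> is the Frobenius norm.\<close>

definition matrix_opnorm :: "real^'n^'m \<Rightarrow> real" where
  "matrix_opnorm A = onorm (\<lambda>v. A *v v)"

text \<open>Real power with the convention that the zeroth power of 0 is 1, whereas
  \<open>0 powr 0 = 0\<close> in the library.\<close>

definition real_pow :: "real \<Rightarrow> real \<Rightarrow> real" where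
  "real_pow b a = (if a = 0 then 1 else b powr a)"

end

theory Submission
  imports Defs
begin

text \<open>
  Both \<open>f - f2p\<close> and \<open>f\<close> are finite sums of homogeneous polynomials, of degrees at most
  \<open>2p - 1\<close> and \<open>2p\<close> respectively, and differentiation lowers the degree of homogeneity by
  one. Since the gradient of \<open>f2p\<close> has no zero on the compact unit sphere, the gradient
  of \<open>f\<close> grows at least like \<open>|x| ^ (2p - 1)\<close> at infinity, whereas the Hessian of \<open>f\<close>
  grows at most like \<open>|x| ^ (2p - 2)\<close>. On bounded sets the Hessian is bounded.
\<close>

subsection \<open>Gradients of polynomials\<close>

text \<open>Induction over the construction of polynomials; in the linear case \<open>G\<close> is
  the constant Riesz vector of \<open>h\<close>. Since \<open>G\<close> is again polynomial, its
  components have gradients for the same reason, which yields the second derivatives.\<close>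

lemma polynomial_gradient_exists:
  fixes g :: "'a::euclidean_space \<Rightarrow> real"
  assumes "real_polynomial_function g"
  shows "\<exists>G. polynomial_function G \<and> (\<forall>x. GDERIV g x :> G x)"
  using assms
proof (induction rule: real_polynomial_function.induct)
  case (linear h)
  then interpret bounded_linear h .
  have "h v = inner v (\<Sum>b\<in>Basis. h b *\<^sub>R b)" for v
  proof -
    have "h v = h (\<Sum>b\<in>Basis. (v \<bullet> b) *\<^sub>R b)"
      by (simp add: euclidean_representation)
    also have "\<dots> = inner v (\<Sum>b\<in>Basis. h b *\<^sub>R b)"
      by (simp add: sum scaleR inner_sum_right mult.commute)
    finally show ?thesis .
  qed
  moreover have "(h has_derivative h) (at x)" for x
    by (rule bounded_linear_imp_has_derivative) (rule linear.hyps)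
  ultimately have "GDERIV h x :> (\<Sum>b\<in>Basis. h b *\<^sub>R b)" for x
    unfolding gderiv_def by (metis (no_types, lifting) ext)
  then show ?case
    by (intro exI[of _ "\<lambda>_. \<Sum>b\<in>Basis. h b *\<^sub>R b"]) simp
next
  case (const c)
  show ?case
    by (rule exI[of _ "\<lambda>_. 0"]) (auto intro: GDERIV_const)
next
  case (add f g)
  then obtain F G where "polynomial_function F" "polynomial_function G"
    and "\<And>x. GDERIV f x :> F x" "\<And>x. GDERIV g x :> G x" by blast
  then show ?case
    by (intro exI[of _ "\<lambda>x. F x + G x"]) (auto intro: GDERIV_add)
next
  case (mult f g)
  then obtain F G where "polynomial_function F" "polynomial_function G"
    and "\<And>x. GDERIV f x :> F x" "\<And>x. GDERIV g x :> G x" by blast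
  with mult.hyps show ?case
    by (intro exI[of _ "\<lambda>x. f x *\<^sub>R G x + g x *\<^sub>R F x"])
      (auto intro!: GDERIV_mult simp: real_polynomial_function_eq)
qed

lemma
  fixes g :: "'a::euclidean_space \<Rightarrow> real"
  assumes "real_polynomial_function g"
  shows GDERIV_gradient: "GDERIV g x :> gradient g x"
    and polynomial_function_gradient: "polynomial_function (gradient g)"
proof -
  obtain G where G: "polynomial_function G" "\<And>x. GDERIV g x :> G x"
    using polynomial_gradient_exists[OF assms] by blast
  then have "gradient g = G"
    by (intro ext gradient_eqI)
  with G show "GDERIV g x :> gradient g x" "polynomial_function (gradient g)"
    by simp_all
qed

lemma gradient_add:
  fixes g h :: "'a::euclidean_space \<Rightarrow> real"
  assumes "real_polynomial_function g" "real_polynomial_function h"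
  shows "gradient (\<lambda>x. g x + h x) = (\<lambda>x. gradient g x + gradient h x)"
  by (intro ext gradient_eqI GDERIV_add GDERIV_gradient assms)

lemma real_polynomial_function_inner:
  fixes P Q :: "'a::real_normed_vector \<Rightarrow> 'b::euclidean_space"
  assumes "polynomial_function P" "polynomial_function Q"
  shows "real_polynomial_function (\<lambda>x. P x \<bullet> Q x)"
proof -
  have "real_polynomial_function (\<lambda>x. R x \<bullet> b)"
    if "polynomial_function R" for R :: "'a \<Rightarrow> 'b" and b
    using that bounded_linear_inner_left unfolding polynomial_function_def o_def by blast
  then have "real_polynomial_function (\<lambda>x. \<Sum>b\<in>Basis. (P x \<bullet> b) * (Q x \<bullet> b))"
    using assms by (intro real_polynomial_function_sum real_polynomial_function.intros(4)) auto
  then show ?thesis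
    by (subst euclidean_inner)
qed

lemma real_polynomial_function_gradient_nth:
  fixes g :: "real^'n \<Rightarrow> real"
  assumes "real_polynomial_function g"
  shows "real_polynomial_function (\<lambda>x. gradient g x $ i)"
  using polynomial_function_gradient[OF assms] bounded_linear_vec_nth
  unfolding polynomial_function_def o_def by blast

text \<open>The rows of the Hessian are the gradients of the components of the gradient, so
  Cauchy-Schwarz applies row by row. This reduces Hessian estimates to gradients of scalar
  polynomials.\<close>

lemma hessian_opnorm_le:
  fixes g :: "real^'n \<Rightarrow> real"
  assumes "real_polynomial_function g"
  shows "matrix_opnorm (hessian g x) \<le> (\<Sum>i\<in>UNIV. norm (gradient (\<lambda>z. gradient g z $ i) x))"
proof -
  let ?D = "\<lambda>v. \<chi> i. v \<bullet> gradient (\<lambda>z. gradient g z $ i) x"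
  have "((\<lambda>z. gradient g z $ i) has_derivative (\<lambda>v. ?D v $ i)) (at x)" for i
    using GDERIV_gradient[OF real_polynomial_function_gradient_nth[OF assms]]
    by (simp add: gderiv_def)
  then have D: "(gradient g has_derivative ?D) (at x)"
    by (subst has_derivative_componentwise_within) (auto simp: Basis_vec_def inner_axis)
  then have "frechet_derivative (gradient g) (at x) = ?D"
    by (rule frechet_derivative_at[symmetric])
  then have H: "hessian g x *v v = ?D v" for v
    unfolding hessian_def jacobian_def
    using has_derivative_linear[OF D] by (simp add: matrix_works)
  have "norm (?D v) \<le> (\<Sum>i\<in>UNIV. norm (gradient (\<lambda>z. gradient g z $ i) x)) * norm v" for v
  proof -
    have "norm (?D v) \<le> (\<Sum>i\<in>UNIV. \<bar>?D v $ i\<bar>)"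
      by (rule norm_le_l1_cart)
    also have "\<dots> \<le> (\<Sum>i\<in>UNIV. norm (gradient (\<lambda>z. gradient g z $ i) x) * norm v)"
      by (intro sum_mono) (metis Cauchy_Schwarz_ineq2 mult.commute vec_lambda_beta)
    finally show ?thesis
      by (simp add: sum_distrib_right)
  qed
  then show ?thesis
    unfolding matrix_opnorm_def H by (rule onorm_le)
qed

subsection \<open>Growth at infinity\<close>

text \<open>Away from the unit ball \<open>norm x powr s\<close> increases with \<open>s\<close>, so
  lower-order terms satisfy the weaker bound too, and negative exponents cause no
  singularity.\<close>

definition growth_le :: "real \<Rightarrow> ('a::real_normed_vector \<Rightarrow> 'b::real_normed_vector) \<Rightarrow> bool" where
  "growth_le s g \<longleftrightarrow> (\<exists>M. \<forall>x. norm x \<ge> 1 \<longrightarrow> norm (g x) \<le> M * norm x powr s)"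

text \<open>Real exponents, so that derivatives of polynomials of degree 0 and 1 need no special
  case: they are formally homogeneous of degree \<open>-1\<close> or \<open>-2\<close>.\<close>

definition pos_homogeneous :: "real \<Rightarrow> ('a::real_vector \<Rightarrow> 'b::real_vector) \<Rightarrow> bool" where
  "pos_homogeneous s g \<longleftrightarrow> (\<forall>x. \<forall>t>0. g (t *\<^sub>R x) = t powr s *\<^sub>R g x)"

lemma growth_le_add:
  assumes "growth_le s g" "growth_le s h"
  shows "growth_le s (\<lambda>x. g x + h x)"
proof -
  obtain M N where "\<And>x. norm x \<ge> 1 \<Longrightarrow> norm (g x) \<le> M * norm x powr s"
    and "\<And>x. norm x \<ge> 1 \<Longrightarrow> norm (h x) \<le> N * norm x powr s"
    using assms unfolding growth_le_def by blast
  then have "norm (g x + h x) \<le> (M + N) * norm x powr s" if "norm x \<ge> 1" for x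
    using that by (metis add_mono distrib_right norm_triangle_mono)
  then show ?thesis
    unfolding growth_le_def by blast
qed

lemma growth_le_sum:
  assumes "finite I" "\<And>i. i \<in> I \<Longrightarrow> growth_le s (g i)"
  shows "growth_le s (\<lambda>x. \<Sum>i\<in>I. g i x)"
  using assms
proof (induction I rule: finite_induct)
  case empty
  have "growth_le s (\<lambda>x. 0)"
    unfolding growth_le_def by (rule exI[of _ 0]) simp
  then show ?case by simp
qed (simp add: growth_le_add)

lemma growth_le_norm:
  "growth_le s (\<lambda>x. norm (g x)) \<longleftrightarrow> growth_le s g"
  unfolding growth_le_def by simp

lemma homogeneous_sphere:
  fixes g :: "'a::real_normed_vector \<Rightarrow> 'b::real_normed_vector"
  assumes "pos_homogeneous s g" "x \<noteq> 0"
  shows "norm (g x) = norm x powr s * norm (g (sgn x))"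
proof -
  have "g (norm x *\<^sub>R sgn x) = norm x powr s *\<^sub>R g (sgn x)"
    using assms unfolding pos_homogeneous_def by simp
  then show ?thesis
    using assms(2) by (simp add: sgn_div_norm)
qed

text \<open>A continuous map is bounded on the compact unit sphere, and homogeneity carries this
  bound along each ray.\<close>

lemma growth_le_homogeneous:
  fixes g :: "'a::euclidean_space \<Rightarrow> 'b::real_normed_vector"
  assumes "continuous_on UNIV g" "pos_homogeneous r g" "r \<le> s"
  shows "growth_le s g"
proof -
  have "bounded (g ` sphere 0 1)"
    using assms(1) by (intro compact_imp_bounded compact_continuous_image)
      (auto intro: continuous_on_subset)
  then obtain M where M: "\<And>u. norm u = 1 \<Longrightarrow> norm (g u) \<le> M" and "M > 0"
    unfolding bounded_pos by (metis image_eqI dist_0_norm mem_sphere)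
  have "norm (g x) \<le> M * norm x powr s" if x: "norm x \<ge> 1" for x
  proof -
    have "x \<noteq> 0" using x by auto
    then have "norm (g x) = norm x powr r * norm (g (sgn x))"
      using assms(2) homogeneous_sphere by blast
    also have "\<dots> \<le> norm x powr s * M"
      using M[of "sgn x"] x \<open>x \<noteq> 0\<close> assms(3)
      by (intro mult_mono powr_mono) (auto simp: norm_sgn)
    finally show ?thesis by (simp add: mult.commute)
  qed
  then show ?thesis
    unfolding growth_le_def by blast
qed

text \<open>Differentiate \<open>g (t *\<^sub>R z)\<close> in \<open>z\<close> twice over, by the
  chain rule and by homogeneity, and compare: \<open>t\<close> times the gradient at
  \<open>t *\<^sub>R x\<close> equals \<open>t powr s\<close> times the gradient at
  \<open>x\<close>.\<close>

lemma pos_homogeneous_gradient: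
  fixes g :: "'a::euclidean_space \<Rightarrow> real"
  assumes "real_polynomial_function g" "pos_homogeneous s g"
  shows "pos_homogeneous (s - 1) (gradient g)"
  unfolding pos_homogeneous_def
proof (intro allI impI)
  fix x and t :: real
  assume t: "t > 0"
  have "((\<lambda>z. g (t *\<^sub>R z)) has_derivative (\<lambda>v. (t *\<^sub>R v) \<bullet> gradient g (t *\<^sub>R x))) (at x)"
    using GDERIV_gradient[OF assms(1), of "t *\<^sub>R x"] unfolding gderiv_def
    by (rule has_derivative_compose[rotated]) (auto intro!: derivative_eq_intros)
  then have "GDERIV (\<lambda>z. g (t *\<^sub>R z)) x :> t *\<^sub>R gradient g (t *\<^sub>R x)"
    by (simp add: gderiv_def)
  moreover have "GDERIV (\<lambda>z. g (t *\<^sub>R z)) x :> t powr s *\<^sub>R gradient g x"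
    using assms(2) GDERIV_gradient[OF assms(1), of x] t
    unfolding gderiv_def pos_homogeneous_def by (auto intro!: derivative_eq_intros)
  ultimately have "t *\<^sub>R gradient g (t *\<^sub>R x) = t powr s *\<^sub>R gradient g x"
    using gradient_eqI by metis
  then have "(1 / t) *\<^sub>R t *\<^sub>R gradient g (t *\<^sub>R x) = (t powr s / t) *\<^sub>R gradient g x"
    by simp
  then show "gradient g (t *\<^sub>R x) = t powr (s - 1) *\<^sub>R gradient g x"
    using t by (simp add: powr_diff)
qed

section \<open>Growth of first and second derivatives\<close>

text \<open>The derivative bounds expected of a polynomial of degree at most \<open>s\<close>,
  bundled so that they pass to sums and need checking only on homogeneous pieces.\<close>

definition poly_growth_le :: "real \<Rightarrow> (real^'n \<Rightarrow> real) \<Rightarrow> bool" where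
  "poly_growth_le s g \<longleftrightarrow> real_polynomial_function g \<and> growth_le (s - 1) (gradient g) \<and>
     (\<forall>i. growth_le (s - 2) (gradient (\<lambda>x. gradient g x $ i)))"

lemma poly_growth_le_add:
  assumes "poly_growth_le s g" "poly_growth_le s h"
  shows "poly_growth_le s (\<lambda>x. g x + h x)"
  using assms unfolding poly_growth_le_def
  by (simp add: gradient_add real_polynomial_function.intros(3) real_polynomial_function_gradient_nth
      growth_le_add)

lemma poly_growth_le_homogeneous:
  assumes "real_polynomial_function g" "pos_homogeneous r g" "r \<le> s"
  shows "poly_growth_le s g"
proof -
  have 1: "pos_homogeneous (r - 1) (gradient g)"
    using assms by (simp add: pos_homogeneous_gradient)
  have "pos_homogeneous (r - 2) (gradient (\<lambda>x. gradient g x $ i))" for i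
  proof -
    have "pos_homogeneous (r - 1) (\<lambda>x. gradient g x $ i)"
      using 1 unfolding pos_homogeneous_def by simp
    from pos_homogeneous_gradient[OF real_polynomial_function_gradient_nth[OF assms(1)] this]
    show ?thesis by simp
  qed
  with 1 show ?thesis
    unfolding poly_growth_le_def using assms
    by (intro conjI allI growth_le_homogeneous[OF _ 1] growth_le_homogeneous
        continuous_on_polymonial_function polynomial_function_gradient
        real_polynomial_function_gradient_nth) auto
qed

lemma poly_growth_le_sum:
  assumes "finite I" "\<And>i. i \<in> I \<Longrightarrow> poly_growth_le s (g i)"
  shows "poly_growth_le s (\<lambda>x. \<Sum>i\<in>I. g i x)"
  using assms
proof (induction I rule: finite_induct)
  case empty
  \<comment> \<open>The zero polynomial is homogeneous of every degree, so degree \<open>s\<close>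
    itself serves.\<close>
  have "poly_growth_le s (\<lambda>x::real^'n. 0)"
    by (rule poly_growth_le_homogeneous[of _ s]) (auto simp: pos_homogeneous_def)
  then show ?case by simp
qed (simp add: poly_growth_le_add)

lemma hessian_growth:
  assumes "poly_growth_le s g"
  obtains M where "\<And>x. norm x \<ge> 1 \<Longrightarrow> matrix_opnorm (hessian g x) \<le> M * norm x powr (s - 2)"
proof -
  have g: "real_polynomial_function g"
    using assms poly_growth_le_def by blast
  have "growth_le (s - 2) (\<lambda>x. \<Sum>i\<in>UNIV. norm (gradient (\<lambda>z. gradient g z $ i) x))"
    using assms unfolding poly_growth_le_def by (intro growth_le_sum) (auto simp: growth_le_norm)
  then obtain M where "\<And>x. norm x \<ge> 1 \<Longrightarrow>
      (\<Sum>i\<in>UNIV. norm (gradient (\<lambda>z. gradient g z $ i) x)) \<le> M * norm x powr (s - 2)"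
    unfolding growth_le_def by (auto simp: abs_le_iff)
  with hessian_opnorm_le[OF g] show ?thesis
    by (meson order_trans that)
qed

lemma hessian_bounded_on_ball:
  assumes "real_polynomial_function g"
  obtains M where "\<And>x. norm x \<le> R \<Longrightarrow> matrix_opnorm (hessian g x) \<le> M"
proof -
  let ?h = "\<lambda>x. \<Sum>i\<in>UNIV. norm (gradient (\<lambda>z. gradient g z $ i) x)"
  have "continuous_on UNIV ?h"
    by (intro continuous_intros continuous_on_polymonial_function polynomial_function_gradient
        real_polynomial_function_gradient_nth assms)
  then have "bounded (?h ` cball 0 R)"
    by (intro compact_imp_bounded compact_continuous_image) (auto intro: continuous_on_subset)
  then obtain M where M: "\<forall>z\<in>?h ` cball 0 R. norm z \<le> M"
    unfolding bounded_iff by blast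
  have "?h x \<le> M" if "norm x \<le> R" for x
  proof -
    have "norm (?h x) \<le> M"
      using that by (intro M[rule_format] imageI) simp
    then show ?thesis by simp
  qed
  with hessian_opnorm_le[OF assms] show ?thesis
    by (meson order_trans that)
qed

text \<open>The norm of \<open>g\<close> attains its minimum on the compact sphere; as
  \<open>g\<close> has no zero there, that minimum is a positive \<open>c\<close>, and homogeneity
  extends the bound along rays.\<close>

lemma homogeneous_lower_bound:
  fixes g :: "'a::euclidean_space \<Rightarrow> 'b::real_normed_vector"
  assumes "continuous_on UNIV g" "pos_homogeneous s g" "\<And>u. norm u = 1 \<Longrightarrow> g u \<noteq> 0"
  obtains c where "c > 0" "\<And>x. x \<noteq> 0 \<Longrightarrow> norm (g x) \<ge> c * norm x powr s"
proof -
  have "sphere 0 1 \<noteq> ({} :: 'a set)"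
    by simp
  moreover have "continuous_on (sphere 0 1) (\<lambda>u. norm (g u))"
    using assms(1) by (intro continuous_on_norm) (auto intro: continuous_on_subset)
  ultimately obtain u0 :: 'a where u0: "norm u0 = 1"
    and min: "\<And>u. norm u = 1 \<Longrightarrow> norm (g u0) \<le> norm (g u)"
    using continuous_attains_inf[OF compact_sphere] by (metis dist_0_norm mem_sphere)
  show ?thesis
  proof
    show "norm (g u0) > 0"
      using assms(3) u0 by simp
    show "norm (g x) \<ge> norm (g u0) * norm x powr s" if "x \<noteq> 0" for x
      using homogeneous_sphere[OF assms(2) that] min[of "sgn x"] that
      by (simp add: norm_sgn mult.commute mult_left_mono)
  qed
qed

lemma pos_homogeneous_inner:
  assumes "pos_homogeneous j P" "pos_homogeneous k Q"
  shows "pos_homogeneous (j + k) (\<lambda>x. P x \<bullet> Q x)"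
  using assms unfolding pos_homogeneous_def by (simp add: powr_add)

section \<open>Comparing Hessian and gradient of the least-squares objective\<close>

theorem theorem2p2:
  fixes p :: nat
    and \<Phi> :: "real^'n \<Rightarrow> real^'m"
    and \<Phi>c :: "nat \<Rightarrow> real^'n \<Rightarrow> real^'m"
    and y :: "real^'m"
    and f f2p :: "real^'n \<Rightarrow> real"
    and \<alpha> :: real
  assumes "p \<ge> 1"
    and "polynomial_function \<Phi>"
    and "poly_map_degree \<Phi> = p"
    and "\<forall>x. f x = 1/2 * (norm (\<Phi> x - y))\<^sup>2"
    and "\<forall>k\<le>p. homogeneous_poly_map k (\<Phi>c k)"
    and "\<forall>x. \<Phi> x = (\<Sum>k\<le>p. \<Phi>c k x)"
    and "\<forall>x. f2p x = 1/2 * (norm (\<Phi>c p x))\<^sup>2"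
    and "\<forall>u\<in>sphere 0 1. gradient f2p u \<noteq> 0"
    and "\<alpha> = (2 * real p - 2) / (2 * real p - 1)"
  shows "\<exists>L0>0. \<exists>L1>0. \<forall>x.
           matrix_opnorm (hessian f x) \<le> L0 + L1 * real_pow (norm (gradient f x)) \<alpha>"
proof -
  define s where "s = 2 * real p"
  \<comment> \<open>The shift by \<open>y\<close> is absorbed into the constant term, which stays
    homogeneous of degree 0. As \<open>p >= 1\<close>, the leading term is unchanged.\<close>
  define \<Psi> where "\<Psi> k x = (if k = 0 then \<Phi>c 0 x - y else \<Phi>c k x)" for k x
  have poly: "polynomial_function (\<Psi> k)" if "k \<le> p" for k
    using assms(5) that unfolding homogeneous_poly_map_def \<Psi>_def
    by (cases "k = 0") auto
  have hom: "pos_homogeneous (real k) (\<Psi> k)" if "k \<le> p" for k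
  proof (cases "k = 0")
    case True
    have "\<Phi>c 0 (t *\<^sub>R x) = \<Phi>c 0 x" for t x
      using assms(5) unfolding homogeneous_poly_map_def by simp
    with True show ?thesis
      unfolding pos_homogeneous_def \<Psi>_def by simp
  next
    case False
    with assms(5) that show ?thesis
      unfolding pos_homogeneous_def homogeneous_poly_map_def \<Psi>_def
      by (simp add: powr_realpow)
  qed
  have prod: "poly_growth_le r (\<lambda>x. \<Psi> j x \<bullet> \<Psi> k x)"
    if "j \<le> p" "k \<le> p" "real j + real k \<le> r" for j k r
    using that by (intro poly_growth_le_homogeneous[where r = "real j + real k"]
        real_polynomial_function_inner pos_homogeneous_inner poly hom)
  \<comment> \<open>With \<open>a\<close> the leading term and \<open>b\<close> the sum of the lower
    ones, half of \<open>norm (a + b)\<close> squared exceeds half of \<open>norm a\<close> squared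
    by the inner product of \<open>b\<close> with \<open>a + b/2\<close>.\<close>
  define q where "q x = (\<Sum>k<p. \<Psi> k x \<bullet> (\<Psi> p x + (1/2) *\<^sub>R (\<Sum>j<p. \<Psi> j x)))" for x
  have f2p: "f2p = (\<lambda>x. 1/2 * (\<Psi> p x \<bullet> \<Psi> p x))"
    using assms(1,7) by (auto simp: \<Psi>_def power2_norm_eq_inner)
  have f_eq: "f = (\<lambda>x. f2p x + q x)"
  proof
    fix x
    have "\<Phi> x - y = (\<Sum>k\<le>p. \<Psi> k x)"
      using assms(6) by (simp add: \<Psi>_def sum.atMost_shift)
    also have "\<dots> = \<Psi> p x + (\<Sum>k<p. \<Psi> k x)"
      by (simp flip: lessThan_Suc_atMost)
    finally show "f x = f2p x + q x"
      using assms(4) unfolding f2p q_def inner_sum_left[symmetric]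
      by (simp add: power2_norm_eq_inner inner_add_left inner_add_right inner_commute field_simps)
  qed
  have q_sum: "q = (\<lambda>x. \<Sum>k<p. \<Psi> k x \<bullet> \<Psi> p x + (\<Sum>j<p. 1/2 * (\<Psi> k x \<bullet> \<Psi> j x)))"
    by (rule ext) (simp add: q_def inner_add_right inner_sum_right sum_distrib_left)
  have half: "real_polynomial_function (\<lambda>x. 1/2 * (\<Psi> j x \<bullet> \<Psi> k x))"
      "pos_homogeneous (real j + real k) (\<lambda>x. 1/2 * (\<Psi> j x \<bullet> \<Psi> k x))"
    if "j \<le> p" "k \<le> p" for j k
  proof -
    show "pos_homogeneous (real j + real k) (\<lambda>x. 1/2 * (\<Psi> j x \<bullet> \<Psi> k x))"
      using pos_homogeneous_inner[OF hom hom, OF that]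
      unfolding pos_homogeneous_def by simp
  qed (intro real_polynomial_function.intros(2,4)
      real_polynomial_function_inner poly that)
  \<comment> \<open>Every product in \<open>q\<close> has a factor of degree below \<open>p\<close>,
    hence total degree at most \<open>2p - 1\<close>. The case \<open>r = s\<close> serves to add
    \<open>q\<close> to \<open>f2p\<close>; the sharp case \<open>r = s - 1\<close> makes the
    gradient of \<open>q\<close> of lower order than that of \<open>f2p\<close>.\<close>
  have q: "poly_growth_le r q" if "r \<ge> s - 1" for r
    unfolding q_sum
    by (intro poly_growth_le_sum poly_growth_le_add prod
        poly_growth_le_homogeneous[OF half]) (use that in \<open>auto simp: s_def\<close>)
  have f2p_poly: "real_polynomial_function f2p" and f2p_hom: "pos_homogeneous s f2p"
    using half[of p p] unfolding f2p s_def by simp_all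
  have f: "poly_growth_le s f"
    unfolding f_eq
    by (intro poly_growth_le_add poly_growth_le_homogeneous[OF f2p_poly f2p_hom] q) auto
  have f_poly: "real_polynomial_function f" and q_poly: "real_polynomial_function q"
    using f q[of s] unfolding poly_growth_le_def by auto
  have grad_f: "gradient f x = gradient f2p x + gradient q x" for x
    unfolding f_eq gradient_add[OF f2p_poly q_poly] ..

  obtain c where c: "c > 0" "\<And>x. x \<noteq> 0 \<Longrightarrow> norm (gradient f2p x) \<ge> c * norm x powr (s - 1)"
    using homogeneous_lower_bound[of "gradient f2p" "s - 1"] assms(8)
      continuous_on_polymonial_function[OF polynomial_function_gradient[OF f2p_poly]]
      pos_homogeneous_gradient[OF f2p_poly f2p_hom] by (metis dist_0_norm mem_sphere)
  obtain C where C: "\<And>x. norm x \<ge> 1 \<Longrightarrow> norm (gradient q x) \<le> C * norm x powr (s - 2)"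
    using q[of "s - 1"] unfolding poly_growth_le_def growth_le_def by auto
  obtain M where M: "\<And>x. norm x \<ge> 1 \<Longrightarrow> matrix_opnorm (hessian f x) \<le> M * norm x powr (s - 2)"
    using hessian_growth[OF f] by blast
  \<comment> \<open>Beyond \<open>2 * C / c\<close> the bound on the gradient of \<open>q\<close> is
    at most half the lower bound for the gradient of \<open>f2p\<close>; the 1 makes the growth
    estimates available.\<close>
  define R where "R = max 1 (2 * C / c)"
  obtain B where B: "\<And>x. norm x \<le> R \<Longrightarrow> matrix_opnorm (hessian f x) \<le> B"
    using hessian_bounded_on_ball[OF f_poly] by blast
  have s: "s \<ge> 2" "\<alpha> = (s - 2) / (s - 1)"
    using assms(1,9) by (simp_all add: s_def)
  \<comment> \<open>The factor \<open>2 / c\<close> comes from bounding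
    \<open>norm x powr (s - 1)\<close> by the gradient of \<open>f\<close>, and is then raised to
    \<alpha>. As \<open>M\<close> may be nonpositive, \<open>max 1 M\<close> secures
    positivity.\<close>
  define L1 where "L1 = max 1 M * (2 / c) powr \<alpha>"

  have "matrix_opnorm (hessian f x) \<le> max 1 B + L1 * real_pow (norm (gradient f x)) \<alpha>" for x
  proof (cases "norm x \<le> R")
    case True
    have "real_pow (norm (gradient f x)) \<alpha> \<ge> 0" and "L1 \<ge> 0"
      by (simp_all add: real_pow_def L1_def)
    then show ?thesis
      using B[OF True] by (smt (verit) mult_nonneg_nonneg)
  next
    case False
    then have x: "norm x \<ge> 1" "2 * C / c \<le> norm x"
      by (auto simp: R_def)
    then have pow: "norm x * norm x powr (s - 2) = norm x powr (s - 1)"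
      by (smt (verit) powr_mult_base)
    have "C * norm x powr (s - 2) \<le> c / 2 * norm x * norm x powr (s - 2)"
      using x c(1) by (intro mult_right_mono) (simp_all add: field_simps)
    then have "c / 2 * norm x powr (s - 1) \<le> norm (gradient f2p x) - norm (gradient q x)"
      using C[OF x(1)] c(2)[of x] x(1) unfolding mult.assoc pow by fastforce
    also have "\<dots> \<le> norm (gradient f x)"
      unfolding grad_f by (metis norm_diff_ineq)
    finally have grad: "norm x powr (s - 1) \<le> 2 / c * norm (gradient f x)"
      using c(1) by (simp add: field_simps)
    \<comment> \<open>This fixes the exponent: \<open>(s - 1) * \<alpha> = s - 2\<close>, where
      \<open>s >= 2\<close> keeps the denominator of \<alpha> nonzero.\<close>
    have "norm x powr (s - 2) = (norm x powr (s - 1)) powr \<alpha>"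
      using s by (simp add: powr_powr)
    also have "\<dots> \<le> (2 / c * norm (gradient f x)) powr \<alpha>"
      using grad s by (intro powr_mono2) auto
    also have "\<dots> = (2 / c) powr \<alpha> * norm (gradient f x) powr \<alpha>"
      by (subst powr_mult) (use c(1) in auto)
    finally have le: "norm x powr (s - 2) \<le> (2 / c) powr \<alpha> * norm (gradient f x) powr \<alpha>" .
    \<comment> \<open>For \<open>\<alpha> = 0\<close>, that is \<open>p = 1\<close>, the left side
      is 0 or 1 and the right side is 1; otherwise both sides agree.\<close>
    have "norm (gradient f x) powr \<alpha> \<le> real_pow (norm (gradient f x)) \<alpha>"
      by (simp add: real_pow_def)
    then have "norm x powr (s - 2) \<le> (2 / c) powr \<alpha> * real_pow (norm (gradient f x)) \<alpha>"
      using le by (meson mult_left_mono order_trans powr_ge_zero)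
    then have "max 1 M * norm x powr (s - 2) \<le> L1 * real_pow (norm (gradient f x)) \<alpha>"
      by (simp add: L1_def mult.assoc mult_left_mono)
    moreover have "M * norm x powr (s - 2) \<le> max 1 M * norm x powr (s - 2)"
      by (intro mult_right_mono) auto
    ultimately show ?thesis
      using M[OF x(1)] by linarith
  qed
  moreover have "L1 > 0"
    using c(1) by (simp add: L1_def)
  ultimately show ?thesis
    by (intro exI[of _ "max 1 B"] conjI exI[of _ L1]) auto
qed

end
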